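(* Let $p,q\in\mathbb{Z}$ with $|p|,|q|\geq 2$, let $a\in\mathbb{R}$, and let $m,n$ be integers with $|p|+1<m<2|p|-1$ and $n\geq (|q|+1)/2$. Let $$A=\begin{pmatrix} p&0\\ -a&q\end{pmatrix},\qquad \mathcal{D}=\left\{\begin{pmatrix} i\\ j\end{pmatrix}: 0\leq i\leq m-1,\ 0\leq j\leq n-1\right\}\quad (i,j\in\mathbb{Z}),$$ and let $T(A,\mathcal{D})$ be the self-affine set generated by $(A,\mathcal{D})$. (i) If $|q|=2$, then $T(A,\mathcal{D})$ is connected for any $a$. (ii) If $|q|\geq 3$, then $T(A,\mathcal{D})$ is connected if and only if $$|q|(|q|-n)\leq |a|\leq \frac{q^2(n-1)}{|q|-2}\qquad\text{or}\qquad |q|-n\leq |a|\leq \frac{|q|(n-1)}{|q|-2}.$$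
   Context: For an expanding real $2\times 2$ matrix $A$ (all eigenvalues have modulus $>1$) and a finite set $\mathcal{D}\subset\mathbb{R}^2$, the self-affine set $T(A,\mathcal{D})$ is the unique nonempty compact set $T\subset\mathbb{R}^2$ satisfying $T=\bigcup_{d\in\mathcal{D}}A^{-1}(T+d)$; equivalently $T(A,\mathcal{D})=\left\{\sum_{k\geq 1}A^{-k}d_k: d_k\in\mathcal{D}\right\}$. *)

theory Defs
  imports "HOL-Analysis.Analysis"
begin

definition is_self_affine_set :: "real^2^2 \<Rightarrow> (real^2) set \<Rightarrow> (real^2) set \<Rightarrow> bool" where
  "is_self_affine_set A D T \<longleftrightarrow>
     compact T \<and> T \<noteq> {} \<and> T = (\<Union>d\<in>D. (\<lambda>x. matrix_inv A *v (x + d)) ` T)"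

text \<open>For an expanding matrix \<open>A\<close> (all complex eigenvalues of modulus \<open>> 1\<close>) and a finite
  nonempty \<open>D\<close> there is exactly one such set. The definite description is only meaningful in
  that case.\<close>

definition self_affine_set :: "real^2^2 \<Rightarrow> (real^2) set \<Rightarrow> (real^2) set" where
  "self_affine_set A D = (THE T. is_self_affine_set A D T)"

text \<open>The inner vectors are the rows of the matrix.\<close>

definition lower_mat :: "int \<Rightarrow> int \<Rightarrow> real \<Rightarrow> real^2^2" where
  "lower_mat p q a = vector [vector [of_int p, 0], vector [- a, of_int q]]"

definition grid_digits :: "int \<Rightarrow> int \<Rightarrow> (real^2) set" where
  "grid_digits m n =
     {vector [of_int i, of_int j] | i j :: int. 0 \<le> i \<and> i \<le> m - 1 \<and> 0 \<le> j \<and> j \<le> n - 1}"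

end

theory Submission
  imports Defs
begin

text \<open>Write \<open>T\<close> for the self-affine set, \<open>Q = \<bar>q\<bar>\<close>, \<open>b = a/q\<close> and \<open>\<rho> = (\<bar>b\<bar> + n - 1) / (Q - 1)\<close>.
  By Hata's criterion (\<open>attractor_connected\<close>, \<open>attractor_not_connected\<close>), \<open>T\<close> is connected if and only
  if the graph on the digits is connected in which \<open>d\<close> and \<open>e\<close> are joined when the pieces of \<open>T\<close>
  belonging to \<open>d\<close> and \<open>e\<close> meet, that is, when \<open>e - d\<close> is a difference of points of \<open>T\<close>.

  So the differences with integer first coordinate \<open>x\<close> must be found. As \<open>m < 2 \<bar>p\<bar> - 1\<close>, only
  \<open>x = -1, 0, 1\<close> occur, and as \<open>m > \<bar>p\<bar> + 1\<close>, the digit expansion of such a difference can move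
  freely between these three values. The first coordinates thus impose no condition on the second
  one, which is \<open>y = b x + (b x\<^sub>1 + l\<^sub>1) / q + (b x\<^sub>2 + l\<^sub>2) / q\<^sup>2 + \<dots>\<close> with arbitrary
  \<open>x\<^sub>k \<in> {-1, 0, 1}\<close> and integers \<open>\<bar>l\<^sub>k\<bar> < n\<close>. Hence always
  \<open>\<bar>y - b x\<bar> \<le> \<rho>\<close> (\<open>Tdiff_snd_bound\<close>); and since \<open>2 n \<ge> Q + 1\<close>, every such \<open>y\<close> occurs provided that
  \<open>\<bar>b\<bar> \<le> n - 1 + \<rho>\<close> (\<open>vector_mem_Tdiff\<close>).

  Consequently, \<open>(i, j)\<close> and \<open>(i', j')\<close> can only be joined if \<open>\<bar>i' - i\<bar> \<le> 1\<close> and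
  \<open>\<bar>(j' - j) - b (i' - i)\<bar> \<le> \<rho>\<close>. If \<open>\<bar>b\<bar> > n - 1 + \<rho>\<close>, there is no edge between different columns.
  Otherwise these conditions are also sufficient. If \<open>\<rho> \<ge> 1\<close>, the columns are connected and joined to
  each other. If \<open>\<rho> < 1\<close>, there are no edges within a column, and the graph is connected exactly
  if it contains both the horizontal edges (\<open>\<bar>b\<bar> \<le> \<rho>\<close>) and edges that climb by one row
  (\<open>1 - \<bar>b\<bar> \<le> \<rho>\<close>). This gives \<open>connected_T_iff\<close>, and multiplying by \<open>Q - 1\<close> turns the conditions on
  \<open>\<rho>\<close> into the stated ones.\<close>

section \<open>Attractors of contractive iterated function systems\<close>

text \<open>A bounded function whose value at each point is controlled by its value at another point
  of the same set satisfies the bound that the fixed point of the control predicts. This replaces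
  summing geometric series along digit expansions.\<close>
lemma self_improving_bound:
  fixes \<phi> :: "'b \<Rightarrow> real"
  assumes bdd: "bdd_above (\<phi> ` S)" and "1 < b"
    and step: "\<And>s. s \<in> S \<Longrightarrow> \<exists>s'\<in>S. b * \<phi> s \<le> C + \<phi> s'"
    and "s \<in> S"
  shows "\<phi> s \<le> C / (b - 1)"
proof -
  define M where "M = (SUP s\<in>S. \<phi> s)"
  have le_M: "\<phi> t \<le> M" if "t \<in> S" for t
    unfolding M_def using bdd that by (rule cSUP_upper2) simp
  have "\<phi> t \<le> (C + M) / b" if "t \<in> S" for t
  proof -
    obtain t' where "t' \<in> S" "b * \<phi> t \<le> C + \<phi> t'" using step \<open>t \<in> S\<close> by blast
    with le_M[of t'] have "b * \<phi> t \<le> C + M" by simp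
    with \<open>1 < b\<close> show ?thesis by (simp add: field_simps)
  qed
  then have "M \<le> (C + M) / b"
    unfolding M_def using \<open>s \<in> S\<close> by (intro cSUP_least) auto
  with \<open>1 < b\<close> have "M \<le> C / (b - 1)" by (simp add: field_simps)
  with le_M[OF \<open>s \<in> S\<close>] show ?thesis by simp
qed

text \<open>A finite family of continuous maps that contract a common norm-like function \<open>N\<close> by a
  factor \<open>r < 1\<close>. The function \<open>N\<close> need not be the Euclidean norm (which the
  inverse of an expanding matrix can fail to contract); it is only required to dominate it.\<close>
locale contractive_ifs =
  fixes I :: "'i set" and f :: "'i \<Rightarrow> 'a::euclidean_space \<Rightarrow> 'a"
    and N :: "'a \<Rightarrow> real" and r :: real
  assumes finite_I: "finite I" and I_nonempty: "I \<noteq> {}"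
    and cont_f: "i \<in> I \<Longrightarrow> continuous_on UNIV (f i)"
    and cont_N: "continuous_on UNIV N"
    and norm_le_N: "norm x \<le> N x"
    and N_triangle: "N (x + y) \<le> N x + N y"
    and r_nonneg: "0 \<le> r" and r_less_1: "r < 1"
    and contraction: "i \<in> I \<Longrightarrow> N (f i x - f i y) \<le> r * N (x - y)"
begin

text \<open>A nonempty compact set that is the union of its images under all branches.\<close>
definition is_attractor :: "'a set \<Rightarrow> bool" where
  "is_attractor T \<longleftrightarrow> compact T \<and> T \<noteq> {} \<and> T = (\<Union>i\<in>I. f i ` T)"

lemma N_nonneg: "0 \<le> N x"
  using norm_le_N[of x] norm_ge_zero[of x] by linarith

lemma N_bounded:
  assumes "bounded G"
  shows "\<exists>B. \<forall>g\<in>G. N g \<le> B"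
proof -
  have "compact (N ` closure G)"
    using assms cont_N by (intro compact_continuous_image) (auto intro: continuous_on_subset)
  then obtain B where "\<forall>y\<in>N ` closure G. norm y \<le> B"
    using bounded_iff compact_imp_bounded by metis
  then have "\<forall>g\<in>G. N g \<le> B"
    using closure_subset[of G] by fastforce
  then show ?thesis ..
qed

text \<open>Coinduction for attractors: a bounded set, each point of which has a preimage under some
  branch inside the set, lies in every closed nonempty set that is mapped into itself by all
  branches. Indeed the distance of a point of the former to the latter
  shrinks by the factor \<open>r\<close> along each branch.\<close>
lemma coinduct_subset:
  assumes "closed S" "S \<noteq> {}" and sub: "\<And>i. i \<in> I \<Longrightarrow> f i ` S \<subseteq> S"
    and "bounded G" and G: "G \<subseteq> (\<Union>i\<in>I. f i ` G)"
  shows "G \<subseteq> S"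
proof
  fix g assume "g \<in> G"
  obtain s0 where "s0 \<in> S" using \<open>S \<noteq> {}\<close> by auto
  have "bounded ((\<lambda>g. g - s0) ` G)"
    using \<open>bounded G\<close> by (metis (no_types) bounded_translation_minus)
  then obtain B where B: "\<And>g. g \<in> G \<Longrightarrow> N (g - s0) \<le> B"
    using N_bounded by (metis imageI)
  have approx: "\<exists>s\<in>S. N (g - s) \<le> r ^ k * B" if "g \<in> G" for g k
    using that
  proof (induction k arbitrary: g)
    case 0
    then show ?case using B \<open>s0 \<in> S\<close> by auto
  next
    case (Suc k)
    obtain i h where ih: "i \<in> I" "h \<in> G" "g = f i h" using G Suc.prems by auto
    obtain s where s: "s \<in> S" "N (h - s) \<le> r ^ k * B" using Suc.IH ih by blast
    have "N (f i h - f i s) \<le> r * N (h - s)" using contraction ih by blast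
    also have "\<dots> \<le> r * (r ^ k * B)" using s r_nonneg by (intro mult_left_mono)
    finally show ?case using s sub[OF \<open>i \<in> I\<close>] ih by (intro bexI[of _ "f i s"]) (auto simp: mult.assoc)
  qed
  have "g \<in> closure S"
    unfolding closure_approachable
  proof (intro allI impI)
    fix e :: real assume "0 < e"
    have "(\<lambda>k. r ^ k * B) \<longlonglongrightarrow> 0 * B"
      using r_nonneg r_less_1 by (intro tendsto_mult LIMSEQ_power_zero) auto
    then have "\<forall>\<^sub>F k in sequentially. r ^ k * B < e"
      using \<open>0 < e\<close> by (intro order_tendstoD) auto
    then obtain k where "r ^ k * B < e" by (auto dest: eventually_happens)
    then obtain s where "s \<in> S" "N (g - s) < e" using approx[OF \<open>g \<in> G\<close>, of k] by force
    then show "\<exists>s\<in>S. dist s g < e"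
      using norm_le_N[of "g - s"] by (auto simp: dist_norm norm_minus_commute intro!: bexI[of _ s])
  qed
  then show "g \<in> S" using \<open>closed S\<close> by simp
qed

lemma attractor_unique:
  assumes "is_attractor S" "is_attractor T"
  shows "S = T"
proof -
  have "S \<subseteq> T" if "is_attractor S" "is_attractor T" for S T
    using that unfolding is_attractor_def
    by (intro coinduct_subset[of T S]) (auto intro: compact_imp_closed compact_imp_bounded)
  with assms show ?thesis by blast
qed

text \<open>The attractor is the intersection of the images of a sufficiently large \<open>N\<close>-ball under the
  iterates of the union of the branches.\<close>
lemma attractor_exists: "\<exists>T. is_attractor T"
proof -
  define F where "F = (\<lambda>X. \<Union>i\<in>I. f i ` X)"
  define c where "c = (\<Sum>i\<in>I. N (f i 0))"
  define R where "R = max (N 0) (c / (1 - r))"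
  define B where "B = {x. N x \<le> R}"
  define K where "K n = (F ^^ n) B" for n
  have "closed B"
    unfolding B_def using cont_N by (intro closed_Collect_le) auto
  moreover have "bounded B"
    unfolding bounded_iff B_def using norm_le_N order_trans by blast
  ultimately have "compact B" by (simp add: compact_eq_bounded_closed)
  have "B \<noteq> {}" unfolding B_def R_def by (auto intro: exI[of _ 0])
  have F_mono: "F X \<subseteq> F Y" if "X \<subseteq> Y" for X Y using that unfolding F_def by blast
  have "c / (1 - r) \<le> R" unfolding R_def by simp
  then have cR: "r * R + c \<le> R" using r_less_1 by (simp add: field_simps)
  have FB: "F B \<subseteq> B"
  proof
    fix y assume "y \<in> F B"
    then obtain i x where i: "i \<in> I" "x \<in> B" "y = f i x" unfolding F_def by blast
    have "N (f i x) \<le> N (f i x - f i 0) + N (f i 0)"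
      using N_triangle[of "f i x - f i 0" "f i 0"] by simp
    also have "N (f i x - f i 0) \<le> r * N x" using contraction[OF \<open>i \<in> I\<close>, of x 0] by simp
    also have "\<dots> \<le> r * R" using i r_nonneg unfolding B_def by (intro mult_left_mono) auto
    also have "N (f i 0) \<le> c"
      unfolding c_def using i finite_I N_nonneg by (intro member_le_sum) auto
    finally show "y \<in> B" using i cR unfolding B_def by auto
  qed
  have K_Suc: "K (Suc n) = F (K n)" for n unfolding K_def by simp
  have dec1: "K (Suc n) \<subseteq> K n" for n
  proof (induction n)
    case 0 then show ?case using FB by (simp add: K_def)
  next
    case (Suc n) then show ?case using F_mono K_Suc by metis
  qed
  have dec: "K n \<subseteq> K m" if "m \<le> n" for m n
    using lift_Suc_antimono_le[of K, OF dec1 that] .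
  have K_compact: "compact (K n)" and K_ne: "K n \<noteq> {}" for n
  proof (induction n)
    case 0
    { case 1 show ?case using \<open>compact B\<close> by (simp add: K_def) }
    { case 2 show ?case using \<open>B \<noteq> {}\<close> by (simp add: K_def) }
  next
    case (Suc n)
    { case 1 show ?case unfolding K_Suc F_def
        using finite_I Suc cont_f
        by (intro compact_UN compact_continuous_image) (auto intro: continuous_on_subset) }
    { case 2 show ?case unfolding K_Suc F_def using I_nonempty Suc by auto }
  qed
  define T where "T = (\<Inter>n. K n)"
  have "compact T"
    unfolding T_def using K_compact by (intro compact_Inter) auto
  moreover have "T \<noteq> {}"
    unfolding T_def using compact_nest[of K] K_compact K_ne dec by blast
  moreover have "T = F T"
  proof
    have "F T \<subseteq> K n" for n
    proof (cases n)
      case 0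
      have "F T \<subseteq> F (K 0)" unfolding T_def by (rule F_mono) blast
      then show ?thesis using dec1[of 0] 0 unfolding K_Suc by blast
    next
      case (Suc k)
      show ?thesis unfolding Suc K_Suc T_def by (rule F_mono) blast
    qed
    then show "F T \<subseteq> T" unfolding T_def by blast
  next
    show "T \<subseteq> F T"
    proof
      fix x assume "x \<in> T"
      \<comment> \<open>As the \<open>K n\<close> decrease, one of the finitely many branches works for all \<open>n\<close>.\<close>
      have "\<exists>i\<in>I. \<forall>n. x \<in> f i ` K n"
      proof (rule ccontr)
        assume "\<not> ?thesis"
        then obtain n where n: "\<And>i. i \<in> I \<Longrightarrow> x \<notin> f i ` K (n i)" by metis
        define M where "M = Max (n ` I)"
        have "x \<in> F (K M)" using \<open>x \<in> T\<close> unfolding T_def K_Suc[symmetric] by blast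
        then obtain i where i: "i \<in> I" "x \<in> f i ` K M" unfolding F_def by blast
        have "n i \<le> M" unfolding M_def using finite_I i by simp
        with n[OF i(1)] i(2) dec show False by blast
      qed
      then obtain i where i: "i \<in> I" "\<And>n. x \<in> f i ` K n" by blast
      define L where "L n = K n \<inter> f i -` {x}" for n
      have "closed (f i -` {x})"
        using cont_f[OF i(1)] by (intro continuous_closed_vimage) (auto simp: continuous_on_eq_continuous_at)
      then have "compact (L n)" for n
        unfolding L_def using K_compact by (intro compact_Int_closed)
      moreover have "L n \<noteq> {}" for n using i(2)[of n] unfolding L_def by auto
      moreover have "L n \<subseteq> L m" if "m \<le> n" for m n using dec[OF that] unfolding L_def by blast
      ultimately have "(\<Inter>n. L n) \<noteq> {}" by (intro compact_nest) auto
      then obtain z where "\<And>n. z \<in> K n" "f i z = x" unfolding L_def by blast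
      then show "x \<in> F T" using i unfolding F_def T_def by blast
    qed
  qed
  ultimately show ?thesis unfolding is_attractor_def F_def by blast
qed

text \<open>Hata's criterion: the attractor is connected as soon as the graph on the branches, in which two
  branches are joined when their images of the attractor meet, is connected. By induction on
  \<open>k\<close>, any two points of the attractor are joined by a chain with steps of size at most
  \<open>r\<^sup>k * B\<close>: such chains are mapped by the branches to finer chains within the pieces, and these are
  concatenated at common points of neighbouring pieces. A compact set that is chainable at every
  scale is connected.\<close>
lemma attractor_connected:
  assumes T: "is_attractor T"
    and graph: "\<And>i j. i \<in> I \<Longrightarrow> j \<in> I \<Longrightarrow>
      (\<lambda>i j. i \<in> I \<and> j \<in> I \<and> f i ` T \<inter> f j ` T \<noteq> {})\<^sup>*\<^sup>* i j"
  shows "connected T"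
proof -
  have "compact T" and T_eq: "T = (\<Union>i\<in>I. f i ` T)"
    using T unfolding is_attractor_def by blast+
  define step where "step e = (\<lambda>x y. x \<in> T \<and> y \<in> T \<and> N (y - x) \<le> e)" for e
  have "bounded ((\<lambda>(y, x). y - x) ` (T \<times> T))"
    using compact_imp_bounded[OF \<open>compact T\<close>] by (intro bounded_minus)
  then obtain B where B: "\<And>x y. x \<in> T \<Longrightarrow> y \<in> T \<Longrightarrow> N (y - x) \<le> B"
    using N_bounded by fastforce
  have chain: "(step (r ^ k * B))\<^sup>*\<^sup>* x y" if "x \<in> T" "y \<in> T" for k x y
    using that
  proof (induction k arbitrary: x y)
    case 0
    then have "step (r ^ 0 * B) x y" unfolding step_def using B by simp
    then show ?case by blast
  next
    case (Suc k)
    let ?S = "step (r ^ Suc k * B)"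
    have img: "?S (f i u) (f i v)" if "i \<in> I" "step (r ^ k * B) u v" for i u v
    proof -
      have "N (f i v - f i u) \<le> r * N (v - u)" using contraction that by blast
      also have "\<dots> \<le> r * (r ^ k * B)"
        using that r_nonneg unfolding step_def by (intro mult_left_mono) auto
      finally show ?thesis using that T_eq unfolding step_def by (auto simp: mult.assoc)
    qed
    have piece: "?S\<^sup>*\<^sup>* u v" if "i \<in> I" and uv: "u \<in> f i ` T" "v \<in> f i ` T" for i u v
    proof -
      obtain u' v' where uv: "u' \<in> T" "v' \<in> T" "u = f i u'" "v = f i v'" using uv by blast
      have "(step (r ^ k * B))\<^sup>*\<^sup>* u' v'" using Suc.IH uv by blast
      then have "?S\<^sup>*\<^sup>* (f i u') (f i v')"
      proof (induction rule: rtranclp_induct)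
        case base then show ?case by blast
      next
        case (step v w) then show ?case using img[OF \<open>i \<in> I\<close>] by (meson rtranclp.rtrancl_into_rtrancl)
      qed
      then show ?thesis using uv by simp
    qed
    obtain i j where ij: "i \<in> I" "j \<in> I" "x \<in> f i ` T" "y \<in> f j ` T"
      using Suc.prems T_eq by blast
    have "\<forall>v\<in>f j ` T. ?S\<^sup>*\<^sup>* x v"
      using graph[OF ij(1,2)]
    proof (induction rule: rtranclp_induct)
      case base then show ?case using piece ij by blast
    next
      case (step j l)
      then obtain z where "z \<in> f j ` T" "z \<in> f l ` T" by blast
      then show ?case using step piece[of l z] by (meson rtranclp_trans)
    qed
    then show ?case using ij by blast
  qed
  show ?thesis
    unfolding connected_closed_set[OF compact_imp_closed[OF \<open>compact T\<close>]]
  proof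
    assume "\<exists>U V. closed U \<and> closed V \<and> U \<noteq> {} \<and> V \<noteq> {} \<and> U \<union> V = T \<and> U \<inter> V = {}"
    then obtain U V where UV: "closed U" "closed V" "U \<noteq> {}" "V \<noteq> {}" "U \<union> V = T" "U \<inter> V = {}"
      by blast
    have "compact U" using \<open>compact T\<close> UV by (metis Int_absorb1 Un_upper1 compact_Int_closed)
    then obtain e where e: "0 < e" "\<And>u v. u \<in> U \<Longrightarrow> v \<in> V \<Longrightarrow> e \<le> dist u v"
      using separate_compact_closed UV by metis
    have "(\<lambda>k. r ^ k * B) \<longlonglongrightarrow> 0 * B"
      using r_nonneg r_less_1 by (intro tendsto_mult LIMSEQ_power_zero) auto
    then have "\<forall>\<^sub>F k in sequentially. r ^ k * B < e"
      using \<open>0 < e\<close> by (intro order_tendstoD) auto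
    then obtain k where k: "r ^ k * B < e" by (auto dest: eventually_happens)
    obtain u v where uv: "u \<in> U" "v \<in> V" using UV by blast
    have "(step (r ^ k * B))\<^sup>*\<^sup>* u v" using chain uv UV by blast
    then have "v \<in> U"
    proof (induction rule: rtranclp_induct)
      case base then show ?case using uv by simp
    next
      case (step v w)
      then have "dist v w < e" "w \<in> T"
        using norm_le_N[of "w - v"] k unfolding step_def by (auto simp: dist_norm norm_minus_commute)
      then show ?case using e(2)[of v w] step UV by fastforce
    qed
    then show False using uv UV by blast
  qed
qed

lemma attractor_not_connected:
  assumes T: "is_attractor T" and C: "C \<subseteq> I" "C \<noteq> {}" "C \<noteq> I"
    and no_edge: "\<And>i j. i \<in> C \<Longrightarrow> j \<in> I - C \<Longrightarrow> f i ` T \<inter> f j ` T = {}"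
  shows "\<not> connected T"
proof -
  have "compact T" "T \<noteq> {}" and T_eq: "T = (\<Union>i\<in>I. f i ` T)"
    using T unfolding is_attractor_def by blast+
  define U where "U J = (\<Union>i\<in>J. f i ` T)" for J
  have "closed (U J)" if "J \<subseteq> I" for J
    unfolding U_def using that finite_I cont_f \<open>compact T\<close>
    by (intro compact_imp_closed compact_UN compact_continuous_image)
      (auto intro: continuous_on_subset finite_subset)
  then have "closed (U C)" "closed (U (I - C))" using C by auto
  moreover have "U C \<noteq> {}" "U (I - C) \<noteq> {}" unfolding U_def using C \<open>T \<noteq> {}\<close> by auto
  moreover have "U C \<union> U (I - C) = (\<Union>i\<in>I. f i ` T)" using C(1) unfolding U_def by blast
  then have "U C \<union> U (I - C) = T" using T_eq by (rule trans[OF _ sym])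
  moreover have "U C \<inter> U (I - C) = {}" unfolding U_def using no_edge by blast
  ultimately show ?thesis
    unfolding connected_closed_set[OF compact_imp_closed[OF \<open>compact T\<close>]] by blast
qed

end

section \<open>The branches of the self-affine set\<close>

text \<open>The map that sends \<open>v\<close> to \<open>inverse A (v + d)\<close> for the lower triangular matrix \<open>A\<close> with diagonal
  \<open>p, q\<close> and lower left entry \<open>- a\<close>, written out in coordinates. The digit \<open>d\<close> is represented by
  a pair of integers.\<close>
definition affine_branch :: "int \<Rightarrow> int \<Rightarrow> real \<Rightarrow> int \<times> int \<Rightarrow> real^2 \<Rightarrow> real^2" where
  "affine_branch p q a d v =
     vector [(v$1 + of_int (fst d)) / of_int p,
             (a * ((v$1 + of_int (fst d)) / of_int p) + (v$2 + of_int (snd d))) / of_int q]"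

lemma affine_branch_nth [simp]:
  "affine_branch p q a d v $ 1 = (v$1 + of_int (fst d)) / of_int p"
  "affine_branch p q a d v $ 2 =
     (a * ((v$1 + of_int (fst d)) / of_int p) + (v$2 + of_int (snd d))) / of_int q"
  unfolding affine_branch_def by simp_all

lemma vec2_eq_iff: "v = w \<longleftrightarrow> v$1 = w$1 \<and> v$2 = w$2" for v w :: "'b^2"
  by (simp add: vec_eq_iff forall_2)

lemma eq_affine_branch_iff:
  assumes "p \<noteq> 0" "q \<noteq> 0"
  shows "g = affine_branch p q a d v \<longleftrightarrow>
    v$1 = of_int p * g$1 - of_int (fst d) \<and> v$2 = of_int q * g$2 - a * g$1 - of_int (snd d)"
proof -
  have "g$1 = (v$1 + of_int (fst d)) / of_int p \<longleftrightarrow> v$1 = of_int p * g$1 - of_int (fst d)"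
    using assms by (auto simp: field_simps)
  moreover have "g$2 = (a * g$1 + (v$2 + of_int (snd d))) / of_int q \<longleftrightarrow>
      v$2 = of_int q * g$2 - a * g$1 - of_int (snd d)"
    using assms by (auto simp: field_simps)
  ultimately show ?thesis unfolding vec2_eq_iff affine_branch_nth by metis
qed

lemma matrix_inv_lower_mat:
  assumes "p \<noteq> 0" "q \<noteq> 0"
  shows "matrix_inv (lower_mat p q a) *v (v + vector [of_int i, of_int j]) = affine_branch p q a (i, j) v"
proof -
  let ?A = "lower_mat p q a" and ?u = "affine_branch p q a (i, j) v"
  have "det ?A \<noteq> 0" using assms by (simp add: det_2 lower_mat_def)
  then have inv: "matrix_inv ?A ** ?A = mat 1"
    unfolding matrix_inv_def using invertible_det_nz[of ?A] someI_ex[of "\<lambda>B. ?A ** B = mat 1 \<and> B ** ?A = mat 1"]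
    unfolding invertible_def by blast
  have "?A *v ?u = v + vector [of_int i, of_int j]"
    using assms unfolding vec2_eq_iff
    by (simp add: matrix_vector_mult_def sum_2 lower_mat_def)
  then have "matrix_inv ?A *v (v + vector [of_int i, of_int j]) = (matrix_inv ?A ** ?A) *v ?u"
    by (simp only: matrix_vector_mul_assoc[symmetric])
  then show ?thesis by (simp add: inv)
qed

text \<open>A weighted sum norm. The weight of the first coordinate dominates the shear \<open>a\<close>, so that each
  branch contracts it by \<open>3/4\<close>, whatever the size of \<open>a\<close>.\<close>
definition sheared_norm :: "real \<Rightarrow> real^2 \<Rightarrow> real" where
  "sheared_norm a v = (\<bar>a\<bar> + 1) * \<bar>v$1\<bar> + \<bar>v$2\<bar>"

lemma contractive_ifs_affine_branch:
  assumes "2 \<le> \<bar>p\<bar>" "2 \<le> \<bar>q\<bar>" "finite J" "J \<noteq> {}"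
  shows "contractive_ifs J (affine_branch p q a) (sheared_norm a) (3/4)"
proof
  show "finite J" "J \<noteq> {}" by fact+
  show "continuous_on UNIV (sheared_norm a)"
    unfolding sheared_norm_def by (intro continuous_intros)
  show "continuous_on UNIV (affine_branch p q a d)" for d
  proof -
    have "continuous_on UNIV (\<lambda>v. affine_branch p q a d v $ 1)"
      "continuous_on UNIV (\<lambda>v. affine_branch p q a d v $ 2)"
      unfolding affine_branch_nth using assms(1,2) by (auto intro!: continuous_intros)
    then have "continuous_on UNIV (\<lambda>v. affine_branch p q a d v $ k)" for k
      using exhaust_2[of k] by metis
    then have "continuous_on UNIV (\<lambda>v. \<chi> k. affine_branch p q a d v $ k)"
      by (intro continuous_on_vec_lambda)
    then show ?thesis by simp
  qed
  show "norm v \<le> sheared_norm a v" for v :: "real^2"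
  proof -
    have "norm v \<le> (\<Sum>k\<in>UNIV. \<bar>v$k\<bar>)" by (rule norm_le_l1_cart)
    also have "\<dots> = \<bar>v$1\<bar> + \<bar>v$2\<bar>" by (simp add: sum_2)
    also have "\<dots> \<le> sheared_norm a v" unfolding sheared_norm_def by (simp add: algebra_simps)
    finally show ?thesis .
  qed
  show "sheared_norm a (v + w) \<le> sheared_norm a v + sheared_norm a w" for v w
  proof -
    have "(\<bar>a\<bar> + 1) * \<bar>v$1 + w$1\<bar> \<le> (\<bar>a\<bar> + 1) * (\<bar>v$1\<bar> + \<bar>w$1\<bar>)"
      by (intro mult_left_mono) auto
    then show ?thesis
      unfolding sheared_norm_def using abs_triangle_ineq[of "v$2" "w$2"]
      by (simp add: algebra_simps)
  qed
  show "sheared_norm a (affine_branch p q a d v - affine_branch p q a d w)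
      \<le> 3 / 4 * sheared_norm a (v - w)" for d v w
  proof -
    let ?P = "\<bar>real_of_int p\<bar>" and ?Q = "\<bar>real_of_int q\<bar>"
    let ?x = "\<bar>(v - w)$1\<bar>" and ?y = "\<bar>(v - w)$2\<bar>"
    have PQ: "2 \<le> ?P" "2 \<le> ?Q" using assms by linarith+
    have x: "(affine_branch p q a d v - affine_branch p q a d w) $ 1 = (v - w)$1 / of_int p"
      by (simp add: diff_divide_distrib add_divide_distrib)
    have y: "(affine_branch p q a d v - affine_branch p q a d w) $ 2
        = (a * ((v - w)$1 / of_int p) + (v - w)$2) / of_int q"
      by (simp add: diff_divide_distrib add_divide_distrib algebra_simps)
    have xb: "\<bar>(v - w)$1 / of_int p\<bar> \<le> ?x / 2"
      unfolding abs_divide using PQ by (intro divide_left_mono) auto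
    have "\<bar>a * ((v - w)$1 / of_int p) + (v - w)$2\<bar> \<le> \<bar>a\<bar> * \<bar>(v - w)$1 / of_int p\<bar> + ?y"
      by (metis abs_mult abs_triangle_ineq)
    also have "\<dots> \<le> \<bar>a\<bar> * (?x / 2) + ?y"
      using xb by (intro add_right_mono mult_left_mono) auto
    finally have "\<bar>(a * ((v - w)$1 / of_int p) + (v - w)$2) / of_int q\<bar> \<le> (\<bar>a\<bar> * (?x / 2) + ?y) / 2"
      unfolding abs_divide using PQ by (intro frac_le) auto
    moreover have "(\<bar>a\<bar> + 1) * \<bar>(v - w)$1 / of_int p\<bar> \<le> (\<bar>a\<bar> + 1) * (?x / 2)"
      using xb by (intro mult_left_mono) auto
    ultimately have "sheared_norm a (affine_branch p q a d v - affine_branch p q a d w)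
        \<le> (\<bar>a\<bar> + 1) * (?x / 2) + (\<bar>a\<bar> * (?x / 2) + ?y) / 2"
      unfolding sheared_norm_def x y by linarith
    also have "\<dots> \<le> 3 / 4 * sheared_norm a (v - w)"
      unfolding sheared_norm_def by (simp add: field_simps)
    finally show ?thesis .
  qed
qed simp_all

section \<open>Differences of points of the self-affine set\<close>

text \<open>The parameters of the theorem, with the hypothesis on \<open>n\<close> stated in the integers.\<close>
locale sheared_grid =
  fixes p q m n :: int and a :: real
  assumes p_ge: "2 \<le> \<bar>p\<bar>" and q_ge: "2 \<le> \<bar>q\<bar>"
    and m_gt: "\<bar>p\<bar> + 1 < m" and m_less: "m < 2 * \<bar>p\<bar> - 1"
    and n_ge: "\<bar>q\<bar> + 1 \<le> 2 * n"
begin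

text \<open>The digits, indexed by their integer coordinates.\<close>
definition cells :: "(int \<times> int) set" where
  "cells = {0..m - 1} \<times> {0..n - 1}"

text \<open>The differences of two digits.\<close>
definition cell_diffs :: "(int \<times> int) set" where
  "cell_diffs = {- (m - 1)..m - 1} \<times> {- (n - 1)..n - 1}"

abbreviation branch :: "int \<times> int \<Rightarrow> real^2 \<Rightarrow> real^2" where
  "branch \<equiv> affine_branch p q a"

lemma n_ge_2: "2 \<le> n" and m_ge_2: "2 \<le> m"
  using n_ge m_gt q_ge p_ge by linarith+

sublocale grid: contractive_ifs cells branch "sheared_norm a" "3/4"
  using p_ge q_ge n_ge_2 m_ge_2 unfolding cells_def
  by (intro contractive_ifs_affine_branch) auto

sublocale diff: contractive_ifs cell_diffs branch "sheared_norm a" "3/4"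
  using p_ge q_ge n_ge_2 m_ge_2 unfolding cell_diffs_def
  by (intro contractive_ifs_affine_branch) auto

lemma is_self_affine_set_iff:
  "is_self_affine_set (lower_mat p q a) (grid_digits m n) T \<longleftrightarrow> grid.is_attractor T"
proof -
  have digits: "grid_digits m n = (\<lambda>(i, j). vector [of_int i, of_int j]) ` cells"
    unfolding grid_digits_def cells_def by (auto simp: image_iff) blast+
  have "(\<Union>d\<in>grid_digits m n. (\<lambda>x. matrix_inv (lower_mat p q a) *v (x + d)) ` T)
      = (\<Union>d\<in>cells. branch d ` T)"
    unfolding digits using p_ge q_ge by (auto simp: matrix_inv_lower_mat)
  then show ?thesis unfolding is_self_affine_set_def grid.is_attractor_def by simp
qed

text \<open>The self-affine set.\<close>
definition T where "T = self_affine_set (lower_mat p q a) (grid_digits m n)"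

lemma T_attractor: "grid.is_attractor T"
  unfolding T_def self_affine_set_def is_self_affine_set_iff
  using grid.attractor_exists grid.attractor_unique by (metis theI)

lemma compact_T: "compact T" and T_nonempty: "T \<noteq> {}" and T_eq: "T = (\<Union>d\<in>cells. branch d ` T)"
  using T_attractor unfolding grid.is_attractor_def by blast+

text \<open>The set of differences of points of \<open>T\<close>. By \<open>branch_Tdiff\<close> and \<open>Tdiff_expand\<close> below it is the
  attractor of the branches belonging to the differences of digits.\<close>
definition Tdiff where "Tdiff = {s - t |s t. s \<in> T \<and> t \<in> T}"

lemma compact_Tdiff: "compact Tdiff"
  unfolding Tdiff_def by (intro compact_differences compact_T)

lemma branch_diff: "branch d s - branch e t = branch (d - e) (s - t)"
  unfolding vec2_eq_iff
  by (simp add: fst_diff snd_diff diff_divide_distrib add_divide_distrib algebra_simps)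

lemma branch_Tdiff:
  assumes "d \<in> cell_diffs"
  shows "branch d ` Tdiff \<subseteq> Tdiff"
proof
  obtain k l where d: "d = (k, l)" by force
  fix g assume "g \<in> branch d ` Tdiff"
  then obtain s t where st: "s \<in> T" "t \<in> T" "g = branch d (s - t)" unfolding Tdiff_def by blast
  \<comment> \<open>A difference of digits is split into its positive and negative part.\<close>
  let ?u = "(max k 0, max l 0)" and ?v = "(max (-k) 0, max (-l) 0)"
  have "?u \<in> cells" "?v \<in> cells"
    using assms n_ge_2 m_ge_2 unfolding d cells_def cell_diffs_def by auto
  then have "branch ?u s \<in> T" "branch ?v t \<in> T" using st T_eq by blast+
  moreover have "d = ?u - ?v" unfolding d by auto
  then have "g = branch ?u s - branch ?v t" using st by (simp add: branch_diff)
  ultimately show "g \<in> Tdiff" unfolding Tdiff_def by blast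
qed

lemma Tdiff_expand:
  assumes "g \<in> Tdiff"
  shows "\<exists>d\<in>cell_diffs. \<exists>h\<in>Tdiff. g = branch d h"
proof -
  obtain s t where st: "s \<in> T" "t \<in> T" "g = s - t" using assms unfolding Tdiff_def by blast
  obtain u s' where u: "u \<in> cells" "s' \<in> T" "s = branch u s'" using st T_eq by blast
  obtain v t' where v: "v \<in> cells" "t' \<in> T" "t = branch v t'" using st T_eq by blast
  have "u - v \<in> cell_diffs" using u v unfolding cells_def cell_diffs_def by auto
  moreover have "g = branch (u - v) (s' - t')" using st u v by (simp add: branch_diff)
  ultimately show ?thesis using u v unfolding Tdiff_def by blast
qed

text \<open>Two pieces of \<open>T\<close> meet if and only if the difference of their digits lies in \<open>Tdiff\<close>.\<close>
lemma adjacent_iff: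
  "branch d ` T \<inter> branch e ` T \<noteq> {} \<longleftrightarrow> vector [of_int (fst e - fst d), of_int (snd e - snd d)] \<in> Tdiff"
proof -
  have "branch d s = branch e t \<longleftrightarrow> s - t = vector [of_int (fst e - fst d), of_int (snd e - snd d)]" for s t
  proof -
    define g where "g = branch e t"
    have s: "branch d s = g \<longleftrightarrow>
        s$1 = of_int p * g$1 - of_int (fst d) \<and> s$2 = of_int q * g$2 - a * g$1 - of_int (snd d)"
      using p_ge q_ge by (subst eq_commute) (intro eq_affine_branch_iff; simp)
    have t: "t$1 = of_int p * g$1 - of_int (fst e)" "t$2 = of_int q * g$2 - a * g$1 - of_int (snd e)"
      using p_ge q_ge eq_affine_branch_iff[of p q g a e t] g_def by simp_all
    show ?thesis
      unfolding vec2_eq_iff[of "s - t"] g_def[symmetric] s vector_minus_component vector_2 t of_int_diff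
      by linarith
  qed
  then have "(\<exists>s\<in>T. \<exists>t\<in>T. branch d s = branch e t) \<longleftrightarrow>
      (\<exists>s\<in>T. \<exists>t\<in>T. s - t = vector [of_int (fst e - fst d), of_int (snd e - snd d)])"
    by simp
  moreover have "branch d ` T \<inter> branch e ` T \<noteq> {} \<longleftrightarrow> (\<exists>s\<in>T. \<exists>t\<in>T. branch d s = branch e t)"
    by blast
  moreover have "w \<in> Tdiff \<longleftrightarrow> (\<exists>s\<in>T. \<exists>t\<in>T. s - t = w)" for w
    unfolding Tdiff_def by blast
  ultimately show ?thesis by simp
qed

text \<open>Two parameters of \<open>Tdiff\<close>: its points with integer first coordinate \<open>x\<close> lie on the lines \<open>x = -1, 0, 1\<close>, and
  their second coordinate is within \<open>halfwidth\<close> of \<open>slope * x\<close>.\<close>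
definition slope :: real where "slope = a / of_int q"

definition halfwidth :: real where
  "halfwidth = (\<bar>slope\<bar> + of_int (n - 1)) / (of_int \<bar>q\<bar> - 1)"

lemma Tdiff_fst_bound:
  assumes "g \<in> Tdiff" "g$1 = of_int x"
  shows "\<bar>x\<bar> \<le> 1"
proof -
  have "\<bar>g$1\<bar> \<le> of_int (m - 1) / (of_int \<bar>p\<bar> - 1)"
  proof (rule self_improving_bound[where S = Tdiff])
    show "bdd_above ((\<lambda>g. \<bar>g$1\<bar>) ` Tdiff)"
      using compact_Tdiff
      by (intro bounded_imp_bdd_above compact_imp_bounded compact_continuous_image) (intro continuous_intros)
    show "1 < real_of_int \<bar>p\<bar>" using p_ge by linarith
    show "\<exists>h\<in>Tdiff. of_int \<bar>p\<bar> * \<bar>g$1\<bar> \<le> of_int (m - 1) + \<bar>h$1\<bar>" if "g \<in> Tdiff" for g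
    proof -
      obtain d h where dh: "d \<in> cell_diffs" "h \<in> Tdiff" "g = branch d h"
        using Tdiff_expand \<open>g \<in> Tdiff\<close> by blast
      then have h: "h$1 = of_int p * g$1 - of_int (fst d)"
        using p_ge q_ge eq_affine_branch_iff[of p q g a d h] by auto
      have "\<bar>fst d\<bar> \<le> m - 1" using dh(1) unfolding cell_diffs_def by auto
      then have "\<bar>real_of_int (fst d)\<bar> \<le> of_int (m - 1)" by linarith
      with h have "\<bar>of_int p * g$1\<bar> \<le> of_int (m - 1) + \<bar>h$1\<bar>" by linarith
      with dh show ?thesis by (auto simp: abs_mult)
    qed
  qed fact
  also have "\<dots> < 2"
    using m_less p_ge by (simp add: divide_less_eq) linarith
  finally show ?thesis unfolding assms(2) by linarith
qed

text \<open>Multiplying a point of \<open>Tdiff\<close> with integer first coordinate by the matrix and subtracting a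
  difference of digits leaves a point of the same kind, so first coordinates stay in \<open>{-1, 0, 1}\<close>
  along the expansion and the shear contributes at most \<open>\<bar>a\<bar>\<close> in each step.\<close>
lemma Tdiff_snd_bound:
  assumes "g \<in> Tdiff" "g$1 = of_int x"
  shows "\<bar>g$2 - slope * of_int x\<bar> \<le> halfwidth"
proof -
  let ?Q = "real_of_int \<bar>q\<bar>"
  have Q: "2 \<le> ?Q" "q \<noteq> 0" using q_ge by auto
  have telescoped: "N + (Q * s + N) / (Q - 1) = Q * ((s + N) / (Q - 1))" if "1 < Q" for N Q s :: real
    using that by (simp add: field_simps)
  define G where "G = {g \<in> Tdiff. g$1 \<in> \<int>}"
  have step: "\<exists>h\<in>G. \<bar>of_int q * g$2 - a * g$1\<bar> \<le> of_int (n - 1) + \<bar>h$2\<bar>" if "g \<in> G" for g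
  proof -
    obtain d h where dh: "d \<in> cell_diffs" "h \<in> Tdiff" "g = branch d h"
      using Tdiff_expand \<open>g \<in> G\<close> unfolding G_def by blast
    then have h: "h$1 = of_int p * g$1 - of_int (fst d)"
      "h$2 = of_int q * g$2 - a * g$1 - of_int (snd d)"
      using p_ge q_ge eq_affine_branch_iff[of p q g a d h] by auto
    have "h$1 \<in> \<int>" unfolding h using that unfolding G_def by simp
    moreover have "\<bar>snd d\<bar> \<le> n - 1" using dh(1) unfolding cell_diffs_def by auto
    then have "\<bar>real_of_int (snd d)\<bar> \<le> of_int (n - 1)" by linarith
    with h have "\<bar>of_int q * g$2 - a * g$1\<bar> \<le> of_int (n - 1) + \<bar>h$2\<bar>" by linarith
    ultimately show ?thesis using dh unfolding G_def by blast
  qed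
  have bound: "\<bar>g$2\<bar> \<le> (\<bar>a\<bar> + of_int (n - 1)) / (?Q - 1)" if "g \<in> G" for g
  proof (rule self_improving_bound[where S = G])
    have "bdd_above ((\<lambda>g. \<bar>g$2\<bar>) ` Tdiff)"
      using compact_Tdiff
      by (intro bounded_imp_bdd_above compact_imp_bounded compact_continuous_image) (intro continuous_intros)
    then show "bdd_above ((\<lambda>g. \<bar>g$2\<bar>) ` G)"
      by (rule bdd_above_mono) (auto simp: G_def)
    show "1 < ?Q" using Q by linarith
    show "\<exists>h\<in>G. ?Q * \<bar>g$2\<bar> \<le> \<bar>a\<bar> + of_int (n - 1) + \<bar>h$2\<bar>" if "g \<in> G" for g
    proof -
      obtain y where y: "g$1 = of_int y" using \<open>g \<in> G\<close> unfolding G_def by (auto elim: Ints_cases)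
      then have "\<bar>y\<bar> \<le> 1" using Tdiff_fst_bound \<open>g \<in> G\<close> unfolding G_def by blast
      then have "\<bar>g$1\<bar> \<le> 1" unfolding y by linarith
      then have "\<bar>a * g$1\<bar> \<le> \<bar>a\<bar>" by (simp add: abs_mult mult_left_le)
      moreover obtain h where "h \<in> G" "\<bar>of_int q * g$2 - a * g$1\<bar> \<le> of_int (n - 1) + \<bar>h$2\<bar>"
        using step \<open>g \<in> G\<close> by blast
      moreover have "?Q * \<bar>g$2\<bar> = \<bar>of_int q * g$2\<bar>" by (simp add: abs_mult)
      ultimately show ?thesis by (intro bexI[of _ h]) linarith+
    qed
  qed fact
  have "g \<in> G" using assms unfolding G_def by simp
  obtain h where h: "h \<in> G" "\<bar>of_int q * g$2 - a * g$1\<bar> \<le> of_int (n - 1) + \<bar>h$2\<bar>"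
    using step[OF \<open>g \<in> G\<close>] by blast
  have "?Q * \<bar>g$2 - slope * of_int x\<bar> = \<bar>of_int q * (g$2 - slope * of_int x)\<bar>"
    by (simp add: abs_mult)
  also have "of_int q * (g$2 - slope * of_int x) = of_int q * g$2 - a * g$1"
    using Q assms by (simp add: slope_def algebra_simps)
  also have "\<bar>\<dots>\<bar> \<le> of_int (n - 1) + (\<bar>a\<bar> + of_int (n - 1)) / (?Q - 1)"
    using h bound by fastforce
  also have "\<bar>a\<bar> = ?Q * \<bar>slope\<bar>" using Q by (simp add: slope_def abs_divide)
  also have "of_int (n - 1) + (?Q * \<bar>slope\<bar> + of_int (n - 1)) / (?Q - 1) = ?Q * halfwidth"
    unfolding halfwidth_def using Q(1) by (intro telescoped) linarith
  finally show ?thesis using Q by (simp add: mult_le_cancel_left)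
qed

lemma q_real_ge: "2 \<le> real_of_int \<bar>q\<bar>"
  using q_ge by linarith

lemma halfwidth_mult: "halfwidth * (of_int \<bar>q\<bar> - 1) = \<bar>slope\<bar> + of_int (n - 1)"
  unfolding halfwidth_def using q_real_ge by simp

lemma le_halfwidth_iff: "c \<le> halfwidth \<longleftrightarrow> c * (of_int \<bar>q\<bar> - 1) \<le> \<bar>slope\<bar> + of_int (n - 1)"
  unfolding halfwidth_def using q_real_ge by (simp add: pos_le_divide_eq)

lemma halfwidth_ge_half: "1 / 2 \<le> halfwidth"
proof -
  have "\<bar>q\<bar> - 1 \<le> 2 * (n - 1)" using n_ge by simp
  then have "real_of_int (\<bar>q\<bar> - 1) \<le> real_of_int (2 * (n - 1))" by (rule of_int_le_iff[THEN iffD2])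
  then show ?thesis unfolding le_halfwidth_iff by simp
qed

text \<open>As \<open>halfwidth \<ge> 1/2\<close>, the intervals of radius \<open>halfwidth\<close> around consecutive integers leave no
  gap. The lower bound on \<open>halfwidth\<close> is where \<open>2 * n \<ge> \<bar>q\<bar> + 1\<close> enters.\<close>
lemma near_digit:
  assumes "\<bar>z\<bar> \<le> of_int (n - 1) + halfwidth"
  shows "\<exists>l. \<bar>l\<bar> \<le> n - 1 \<and> \<bar>z - of_int l\<bar> \<le> halfwidth"
proof -
  consider "\<bar>z\<bar> \<le> of_int (n - 1)" | "of_int (n - 1) < z" | "z < - of_int (n - 1)" by linarith
  then show ?thesis
  proof cases
    case 1
    then have "round z \<le> round (real_of_int (n - 1))" "round (real_of_int (- (n - 1))) \<le> round z"
      by (intro round_mono; simp)+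
    then have "\<bar>round z\<bar> \<le> n - 1" unfolding round_of_int by linarith
    moreover have "\<bar>z - of_int (round z)\<bar> \<le> halfwidth"
      using of_int_round_abs_le[of z] halfwidth_ge_half by linarith
    ultimately show ?thesis by blast
  next
    case 2
    then show ?thesis using assms n_ge_2 by (intro exI[of _ "n - 1"]) auto
  next
    case 3
    then show ?thesis using assms n_ge_2 by (intro exI[of _ "- (n - 1)"]) auto
  qed
qed

text \<open>The intervals of radius \<open>halfwidth\<close> around \<open>l + slope * e\<close>, for admissible \<open>l\<close> and
  \<open>e \<in> {-1, 0, 1}\<close>, cover the interval of radius \<open>\<bar>q\<bar> * halfwidth\<close>: for the three values of
  \<open>e\<close> they fill three intervals, which overlap by the hypothesis on the slope.\<close>
lemma near_sheared_digit:
  assumes gap: "\<bar>slope\<bar> \<le> of_int (n - 1) + halfwidth"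
    and z: "\<bar>z\<bar> \<le> of_int \<bar>q\<bar> * halfwidth"
  shows "\<exists>e l. \<bar>e\<bar> \<le> 1 \<and> \<bar>l\<bar> \<le> n - 1 \<and> \<bar>z - of_int l - slope * of_int e\<bar> \<le> halfwidth"
proof -
  have near: ?thesis if e: "\<bar>e\<bar> \<le> 1" "\<bar>z - slope * of_int e\<bar> \<le> of_int (n - 1) + halfwidth" for e
  proof -
    obtain l where "\<bar>l\<bar> \<le> n - 1" "\<bar>z - slope * of_int e - of_int l\<bar> \<le> halfwidth"
      using near_digit[OF e(2)] by blast
    with e(1) show ?thesis by (intro exI[of _ e] exI[of _ l]) (simp add: algebra_simps)
  qed
  have eq: "of_int \<bar>q\<bar> * halfwidth - \<bar>slope\<bar> = of_int (n - 1) + halfwidth"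
    using halfwidth_mult by (simp add: algebra_simps)
  define s :: int where "s = (if 0 \<le> slope then 1 else - 1)"
  have s: "slope * of_int s = \<bar>slope\<bar>" "\<bar>s\<bar> \<le> 1" unfolding s_def by auto
  consider "\<bar>z\<bar> \<le> of_int (n - 1) + halfwidth" | "of_int (n - 1) + halfwidth < z"
    | "z < - (of_int (n - 1) + halfwidth)" by linarith
  then show ?thesis
  proof cases
    case 1
    then show ?thesis using near[of 0] by simp
  next
    case 2
    then have "\<bar>z - slope * of_int s\<bar> \<le> of_int (n - 1) + halfwidth"
      unfolding s using z eq gap by linarith
    then show ?thesis using near s by blast
  next
    case 3
    have "slope * of_int (- s) = - \<bar>slope\<bar>" using s by simp
    then have "\<bar>z - slope * of_int (- s)\<bar> \<le> of_int (n - 1) + halfwidth"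
      using 3 z eq gap by linarith
    then show ?thesis using near[of "- s"] s by simp
  qed
qed

text \<open>The converse of \<open>Tdiff_fst_bound\<close> and \<open>Tdiff_snd_bound\<close>, for slopes that are not too steep: the
  union of three vertical segments that these lemmas describe is contained in \<open>Tdiff\<close> by
  coinduction.\<close>
lemma vector_mem_Tdiff:
  assumes gap: "\<bar>slope\<bar> \<le> of_int (n - 1) + halfwidth"
    and "\<bar>x\<bar> \<le> 1" "\<bar>y - slope * of_int x\<bar> \<le> halfwidth"
  shows "vector [of_int x, y] \<in> Tdiff"
proof -
  define G where "G = {g :: real^2. \<exists>x. \<bar>x\<bar> \<le> 1 \<and> g$1 = of_int x \<and> \<bar>g$2 - slope * of_int x\<bar> \<le> halfwidth}"
  have "G \<subseteq> Tdiff"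
  proof (rule diff.coinduct_subset)
    show "closed Tdiff" using compact_Tdiff by (rule compact_imp_closed)
    show "Tdiff \<noteq> {}" unfolding Tdiff_def using T_nonempty by blast
    show "branch d ` Tdiff \<subseteq> Tdiff" if "d \<in> cell_diffs" for d using that by (rule branch_Tdiff)
    show "bounded G"
      unfolding bounded_iff
    proof (intro exI ballI)
      fix g assume "g \<in> G"
      then obtain x where x: "\<bar>x\<bar> \<le> 1" "g$1 = of_int x" "\<bar>g$2 - slope * of_int x\<bar> \<le> halfwidth"
        unfolding G_def by blast
      have x1: "\<bar>real_of_int x\<bar> \<le> 1" using x(1) by linarith
      then have "\<bar>slope * of_int x\<bar> \<le> \<bar>slope\<bar>" by (simp add: abs_mult mult_left_le)
      moreover have "norm g \<le> \<bar>g$1\<bar> + \<bar>g$2\<bar>" using norm_le_l1_cart[of g] by (simp add: sum_2)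
      ultimately show "norm g \<le> 1 + \<bar>slope\<bar> + halfwidth" using x x1 by linarith
    qed
    show "G \<subseteq> (\<Union>d\<in>cell_diffs. branch d ` G)"
    proof
      fix g assume "g \<in> G"
      then obtain x where x: "\<bar>x\<bar> \<le> 1" "g$1 = of_int x" "\<bar>g$2 - slope * of_int x\<bar> \<le> halfwidth"
        unfolding G_def by blast
      define z where "z = of_int q * g$2 - a * g$1"
      have "z = of_int q * (g$2 - slope * of_int x)"
        using q_ge x unfolding z_def slope_def by (auto simp: algebra_simps)
      then have "\<bar>z\<bar> = of_int \<bar>q\<bar> * \<bar>g$2 - slope * of_int x\<bar>" by (simp add: abs_mult)
      also have "\<dots> \<le> of_int \<bar>q\<bar> * halfwidth" using x by (intro mult_left_mono) auto
      finally obtain e l where el: "\<bar>e\<bar> \<le> 1" "\<bar>l\<bar> \<le> n - 1" "\<bar>z - of_int l - slope * of_int e\<bar> \<le> halfwidth"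
        using near_sheared_digit[OF gap] by blast
      let ?d = "(p * x - e, l)" and ?h = "vector [of_int e, z - of_int l] :: real^2"
      \<comment> \<open>Since \<open>\<bar>p\<bar> + 1 < m\<close>, every transition between first coordinates in \<open>{-1, 0, 1}\<close> occurs.\<close>
      have "x = -1 \<or> x = 0 \<or> x = 1" using x by linarith
      then have "\<bar>p * x - e\<bar> \<le> m - 1" using el m_gt by (elim disjE; simp)
      then have "?d \<in> cell_diffs" using el unfolding cell_diffs_def by auto
      moreover have "?h \<in> G" using el unfolding G_def by auto
      moreover have "g = branch ?d ?h"
        using p_ge q_ge x z_def eq_affine_branch_iff[of p q g a ?d ?h] by simp
      ultimately show "g \<in> (\<Union>d\<in>cell_diffs. branch d ` G)" by blast
    qed
  qed
  moreover have "vector [of_int x, y] \<in> G" using assms unfolding G_def by auto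
  ultimately show ?thesis by blast
qed

section \<open>The adjacency graph of the pieces\<close>

text \<open>Adjacency of digits: the corresponding pieces of \<open>T\<close> meet.\<close>
definition adjacent :: "int \<times> int \<Rightarrow> int \<times> int \<Rightarrow> bool" where
  "adjacent d e \<longleftrightarrow> d \<in> cells \<and> e \<in> cells \<and> branch d ` T \<inter> branch e ` T \<noteq> {}"

lemma adjacent_sym: "adjacent d e \<Longrightarrow> adjacent e d"
  unfolding adjacent_def by blast

lemma reach_sym: "adjacent\<^sup>*\<^sup>* d e \<Longrightarrow> adjacent\<^sup>*\<^sup>* e d"
  by (induction rule: rtranclp_induct) (auto intro: converse_rtranclp_into_rtranclp adjacent_sym)

lemma adjacent_bounds:
  assumes "adjacent (i, j) (i', j')"
  shows "\<bar>i' - i\<bar> \<le> 1" "\<bar>of_int (j' - j) - slope * of_int (i' - i)\<bar> \<le> halfwidth"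
proof -
  have "vector [of_int (i' - i), of_int (j' - j)] \<in> Tdiff"
    using assms adjacent_iff[of "(i, j)" "(i', j')"] unfolding adjacent_def by simp
  from Tdiff_fst_bound[OF this] Tdiff_snd_bound[OF this] show
    "\<bar>i' - i\<bar> \<le> 1" "\<bar>of_int (j' - j) - slope * of_int (i' - i)\<bar> \<le> halfwidth"
    by (metis vector_2)+
qed

lemma adjacentI:
  assumes gap: "\<bar>slope\<bar> \<le> of_int (n - 1) + halfwidth"
    and "(i, j) \<in> cells" "(i', j') \<in> cells"
    and "\<bar>i' - i\<bar> \<le> 1" "\<bar>of_int (j' - j) - slope * of_int (i' - i)\<bar> \<le> halfwidth"
  shows "adjacent (i, j) (i', j')"
  using assms vector_mem_Tdiff[OF gap, of "i' - i" "of_int (j' - j)"] adjacent_iff[of "(i, j)" "(i', j')"]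
  unfolding adjacent_def by simp

lemma connected_if_columns_joined:
  assumes vert: "\<And>i j. 0 \<le> i \<Longrightarrow> i < m \<Longrightarrow> 0 \<le> j \<Longrightarrow> j + 1 < n \<Longrightarrow> adjacent\<^sup>*\<^sup>* (i, j) (i, j + 1)"
    and horiz: "\<And>i. 0 \<le> i \<Longrightarrow> i + 1 < m \<Longrightarrow>
      \<exists>j j'. (i, j) \<in> cells \<and> (i + 1, j') \<in> cells \<and> adjacent\<^sup>*\<^sup>* (i, j) (i + 1, j')"
  shows "connected T"
proof (rule grid.attractor_connected[OF T_attractor])
  have col: "adjacent\<^sup>*\<^sup>* (i, 0) (i, int k)" if "0 \<le> i" "i < m" "int k < n" for i k
    using that(3)
  proof (induction k)
    case (Suc k)
    then have "adjacent\<^sup>*\<^sup>* (i, int k) (i, int k + 1)" using that by (intro vert) auto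
    with Suc show ?case by (auto simp: add.commute intro: rtranclp_trans)
  qed simp
  have base: "adjacent\<^sup>*\<^sup>* (i, 0) (i, j)" if "(i, j) \<in> cells" for i j
    using col[of i "nat j"] that unfolding cells_def by auto
  have row: "adjacent\<^sup>*\<^sup>* (0, 0) (int k, 0)" if "int k < m" for k
    using that
  proof (induction k)
    case (Suc k)
    then obtain j j' where jj: "(int k, j) \<in> cells" "(int k + 1, j') \<in> cells"
        "adjacent\<^sup>*\<^sup>* (int k, j) (int k + 1, j')"
      using horiz[of "int k"] by auto
    have "adjacent\<^sup>*\<^sup>* (0, 0) (int k, 0)" using Suc by simp
    also have "adjacent\<^sup>*\<^sup>* (int k, 0) (int k, j)" using base jj by blast
    also note jj(3)
    also have "adjacent\<^sup>*\<^sup>* (int k + 1, j') (int k + 1, 0)" using reach_sym base jj by blast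
    finally show ?case by (simp add: add.commute)
  qed simp
  have origin: "adjacent\<^sup>*\<^sup>* (0, 0) d" if "d \<in> cells" for d
  proof -
    obtain i j where d: "d = (i, j)" by force
    have "adjacent\<^sup>*\<^sup>* (0, 0) (i, 0)" using row[of "nat i"] that unfolding d cells_def by auto
    with base that show ?thesis unfolding d by (blast intro: rtranclp_trans)
  qed
  show "(\<lambda>d e. d \<in> cells \<and> e \<in> cells \<and> branch d ` T \<inter> branch e ` T \<noteq> {})\<^sup>*\<^sup>* d e"
    if "d \<in> cells" "e \<in> cells" for d e
    using rtranclp_trans[OF reach_sym[OF origin] origin] that
    unfolding adjacent_def[abs_def] by blast
qed

lemma connected_if_halfwidth_ge_1:
  assumes gap: "\<bar>slope\<bar> \<le> of_int (n - 1) + halfwidth" and hw: "1 \<le> halfwidth"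
  shows "connected T"
proof (rule connected_if_columns_joined)
  fix i j assume "0 \<le> i" "i < m" "0 \<le> j" "j + 1 < n"
  then have "adjacent (i, j) (i, j + 1)"
    using hw by (intro adjacentI[OF gap]) (auto simp: cells_def)
  then show "adjacent\<^sup>*\<^sup>* (i, j) (i, j + 1)" by blast
next
  fix i assume i: "0 \<le> i" "i + 1 < m"
  obtain l where l: "\<bar>l\<bar> \<le> n - 1" "\<bar>slope - of_int l\<bar> \<le> halfwidth" using near_digit[OF gap] by blast
  let ?j = "max 0 (- l)" and ?j' = "max 0 l"
  have l_eq: "?j' - ?j = l" by linarith
  have cells: "(i, ?j) \<in> cells" "(i + 1, ?j') \<in> cells" using i l unfolding cells_def by auto
  then have "adjacent (i, ?j) (i + 1, ?j')"
    using l(2) by (intro adjacentI[OF gap]) (simp_all only: l_eq, simp_all add: abs_minus_commute)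
  with cells show "\<exists>j j'. (i, j) \<in> cells \<and> (i + 1, j') \<in> cells \<and> adjacent\<^sup>*\<^sup>* (i, j) (i + 1, j')"
    by blast
qed

text \<open>Here \<open>(i, j)\<close> is adjacent to \<open>(i + 1, j)\<close>, and to one of the two neighbours of \<open>(i + 1, j)\<close> in its
  column, the direction depending on the sign of the slope. Consecutive digits of a column have
  then a common neighbour in the next (or, for the last column, the previous) column.\<close>
lemma connected_if_zigzag:
  assumes "\<bar>slope\<bar> \<le> halfwidth" "1 - \<bar>slope\<bar> \<le> halfwidth"
  shows "connected T"
proof (rule connected_if_columns_joined)
  have gap: "\<bar>slope\<bar> \<le> of_int (n - 1) + halfwidth" using assms n_ge_2 by linarith
  have flat: "adjacent (i, j) (i + 1, j)" if "0 \<le> i" "i + 1 < m" "0 \<le> j" "j < n" for i j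
    using assms that by (intro adjacentI[OF gap]) (auto simp: cells_def)
  have up: "adjacent (i, j) (i + 1, j + 1)"
    if "0 \<le> slope" "0 \<le> i" "i + 1 < m" "0 \<le> j" "j + 1 < n" for i j
    using assms that by (intro adjacentI[OF gap]) (auto simp: cells_def)
  have down: "adjacent (i, j + 1) (i + 1, j)"
    if "slope < 0" "0 \<le> i" "i + 1 < m" "0 \<le> j" "j + 1 < n" for i j
    using assms that by (intro adjacentI[OF gap]) (auto simp: cells_def)
  {
    fix i j assume ij: "0 \<le> i" "i < m" "0 \<le> j" "j + 1 < n"
    have "\<exists>d. adjacent (i, j) d \<and> adjacent d (i, j + 1)"
    proof (cases "i + 1 < m"; cases "0 \<le> slope")
      assume "i + 1 < m" "0 \<le> slope"
      then show ?thesis using ij up[of i j] flat[of i "j + 1"] adjacent_sym by fastforce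
    next
      assume "i + 1 < m" "\<not> 0 \<le> slope"
      then show ?thesis using ij down[of i j] flat[of i j] adjacent_sym by fastforce
    next
      assume "\<not> i + 1 < m" "0 \<le> slope"
      then show ?thesis using ij m_ge_2 up[of "i - 1" j] flat[of "i - 1" j] adjacent_sym by fastforce
    next
      assume "\<not> i + 1 < m" "\<not> 0 \<le> slope"
      then show ?thesis using ij m_ge_2 down[of "i - 1" j] flat[of "i - 1" "j + 1"] adjacent_sym by fastforce
    qed
    then show "adjacent\<^sup>*\<^sup>* (i, j) (i, j + 1)" by (meson r_into_rtranclp rtranclp_trans)
  next
    fix i assume i: "0 \<le> i" "i + 1 < m"
    then have "adjacent (i, 0) (i + 1, 0)" using n_ge_2 by (intro flat) auto
    then show "\<exists>j j'. (i, j) \<in> cells \<and> (i + 1, j') \<in> cells \<and> adjacent\<^sup>*\<^sup>* (i, j) (i + 1, j')"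
      unfolding adjacent_def by blast
  }
qed

lemma not_connected_if_isolated:
  assumes "C \<subseteq> cells" "c \<in> C" "d \<in> cells" "d \<notin> C"
    and "\<And>i j i' j'. (i, j) \<in> C \<Longrightarrow> (i', j') \<in> cells - C \<Longrightarrow> adjacent (i, j) (i', j') \<Longrightarrow> False"
  shows "\<not> connected T"
proof (rule grid.attractor_not_connected[OF T_attractor])
  fix d e assume de: "d \<in> C" "e \<in> cells - C"
  obtain i j i' j' where "d = (i, j)" "e = (i', j')" by force
  then show "branch d ` T \<inter> branch e ` T = {}"
    using assms(5)[of i j i' j'] de assms(1) unfolding adjacent_def by blast
qed (use assms in blast)+

lemma cells_differ_less:
  assumes "(i, j) \<in> cells" "(i', j') \<in> cells"
  shows "\<bar>real_of_int (j' - j)\<bar> \<le> of_int (n - 1)"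
proof -
  have "\<bar>j' - j\<bar> \<le> n - 1" using assms unfolding cells_def by auto
  then show ?thesis by linarith
qed

lemma slope_mult_unit:
  assumes "\<bar>x :: int\<bar> = 1"
  shows "\<bar>slope * of_int x\<bar> = \<bar>slope\<bar>"
  using assms by (simp add: abs_mult flip: of_int_abs)

text \<open>The first column has no neighbour outside.\<close>
lemma not_connected_if_steep:
  assumes "of_int (n - 1) + halfwidth < \<bar>slope\<bar>"
  shows "\<not> connected T"
proof (rule not_connected_if_isolated[where C = "{0} \<times> {0..n - 1}" and c = "(0, 0)" and d = "(1, 0)"])
  fix i j i' j' assume ij: "(i, j) \<in> {0} \<times> {0..n - 1}" "(i', j') \<in> cells - {0} \<times> {0..n - 1}"
    and adj: "adjacent (i, j) (i', j')"
  have "\<bar>i' - i\<bar> = 1" using adjacent_bounds(1)[OF adj] ij unfolding cells_def by auto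
  from slope_mult_unit[OF this] show False
    using adjacent_bounds(2)[OF adj] cells_differ_less[of i j i' j'] adj assms
    unfolding adjacent_def by linarith
qed (use n_ge_2 m_ge_2 in \<open>auto simp: cells_def\<close>)

text \<open>All edges are horizontal, so the bottom row has no neighbour outside.\<close>
lemma not_connected_if_flat:
  assumes "\<bar>slope\<bar> + halfwidth < 1"
  shows "\<not> connected T"
proof (rule not_connected_if_isolated[where C = "{0..m - 1} \<times> {0}" and c = "(0, 0)" and d = "(0, 1)"])
  fix i j i' j' assume ij: "(i, j) \<in> {0..m - 1} \<times> {0}" "(i', j') \<in> cells - {0..m - 1} \<times> {0}"
    and adj: "adjacent (i, j) (i', j')"
  have "\<bar>real_of_int (i' - i)\<bar> \<le> 1" using adjacent_bounds(1)[OF adj] by linarith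
  then have "\<bar>slope * of_int (i' - i)\<bar> \<le> \<bar>slope\<bar>" by (simp only: abs_mult mult_left_le abs_ge_zero)
  then have "\<bar>real_of_int (j' - j)\<bar> < 1" using adjacent_bounds(2)[OF adj] assms by linarith
  then have "j' = j" by linarith
  with ij show False unfolding cells_def by auto
qed (use n_ge_2 m_ge_2 in \<open>auto simp: cells_def\<close>)

text \<open>There are no vertical edges, and all edges between neighbouring columns rise strictly in the
  direction of the slope. So a corner of the grid is isolated.\<close>
lemma not_connected_if_corner_isolated:
  assumes "halfwidth < 1" "halfwidth < \<bar>slope\<bar>"
  shows "\<not> connected T"
proof (rule not_connected_if_isolated
    [where C = "{(0, if 0 \<le> slope then n - 1 else 0)}" and c = "(0, if 0 \<le> slope then n - 1 else 0)"
       and d = "(1, 0)"])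
  fix i j i' j' assume ij: "(i, j) \<in> {(0, if 0 \<le> slope then n - 1 else 0)}"
      "(i', j') \<in> cells - {(0, if 0 \<le> slope then n - 1 else 0)}"
    and adj: "adjacent (i, j) (i', j')"
  have "i' = 0 \<or> i' = 1" using adjacent_bounds(1)[OF adj] ij unfolding cells_def by auto
  then show False
  proof
    assume "i' = 0"
    then have "\<bar>real_of_int (j' - j)\<bar> < 1" using adjacent_bounds(2)[OF adj] ij assms by auto
    then have "j' = j" by linarith
    with ij \<open>i' = 0\<close> show False by auto
  next
    assume "i' = 1"
    then have b: "\<bar>real_of_int (j' - j) - slope\<bar> \<le> halfwidth" using adjacent_bounds(2)[OF adj] ij by auto
    show False
    proof (cases "0 \<le> slope")
      case True
      then have "0 < real_of_int (j' - j)" using b assms by linarith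
      with ij True show False unfolding cells_def by auto
    next
      case False
      then have "real_of_int (j' - j) < 0" using b assms by linarith
      with ij False show False unfolding cells_def by auto
    qed
  qed
qed (use n_ge_2 m_ge_2 in \<open>auto simp: cells_def\<close>)

text \<open>If the halfwidth is less than 1 and the second alternative fails, then the set is disconnected by
  \<open>not_connected_if_flat\<close> or \<open>not_connected_if_corner_isolated\<close>.\<close>
lemma connected_T_iff:
  "connected T \<longleftrightarrow>
     1 \<le> halfwidth \<and> \<bar>slope\<bar> \<le> of_int (n - 1) + halfwidth \<or>
     1 - \<bar>slope\<bar> \<le> halfwidth \<and> \<bar>slope\<bar> \<le> halfwidth"
  using connected_if_halfwidth_ge_1 connected_if_zigzag not_connected_if_steep
    not_connected_if_flat not_connected_if_corner_isolated n_ge_2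
  by (smt (verit) of_int_0_le_iff)

end

section \<open>The connectedness criterion\<close>

theorem theorem1p3:
  fixes p q m n :: int and a :: real
  assumes "\<bar>p\<bar> \<ge> 2" and "\<bar>q\<bar> \<ge> 2"
    and "\<bar>p\<bar> + 1 < m" and "m < 2 * \<bar>p\<bar> - 1"
    and "real_of_int n \<ge> (real_of_int \<bar>q\<bar> + 1) / 2"
  shows "(\<bar>q\<bar> = 2 \<longrightarrow> connected (self_affine_set (lower_mat p q a) (grid_digits m n))) \<and>
    (\<bar>q\<bar> \<ge> 3 \<longrightarrow>
      (connected (self_affine_set (lower_mat p q a) (grid_digits m n)) \<longleftrightarrow>
        (real_of_int (\<bar>q\<bar> * (\<bar>q\<bar> - n)) \<le> \<bar>a\<bar> \<and>
          \<bar>a\<bar> \<le> real_of_int (q\<^sup>2 * (n - 1)) / real_of_int (\<bar>q\<bar> - 2)) \<or>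
        (real_of_int (\<bar>q\<bar> - n) \<le> \<bar>a\<bar> \<and>
          \<bar>a\<bar> \<le> real_of_int (\<bar>q\<bar> * (n - 1)) / real_of_int (\<bar>q\<bar> - 2))))"
proof -
  have "real_of_int (\<bar>q\<bar> + 1) \<le> real_of_int (2 * n)" using assms(5) by simp
  then have "\<bar>q\<bar> + 1 \<le> 2 * n" by (rule of_int_le_iff[THEN iffD1])
  then interpret sheared_grid p q m n a by unfold_locales (use assms in auto)
  let ?Q = "real_of_int \<bar>q\<bar>" and ?N = "real_of_int (n - 1)" and ?b = "\<bar>slope\<bar>"
  have Q: "2 \<le> ?Q" and N: "1 \<le> ?N" using assms(2) n_ge_2 by linarith+
  have a: "\<bar>a\<bar> = ?Q * ?b" using assms(2) unfolding slope_def by (simp add: abs_divide)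
  have hw: "1 \<le> halfwidth \<longleftrightarrow> ?Q - 1 - ?N \<le> ?b"
    "1 - ?b \<le> halfwidth \<longleftrightarrow> ?Q - 1 - ?N \<le> ?Q * ?b"
    "?b \<le> halfwidth \<longleftrightarrow> ?b * (?Q - 2) \<le> ?N"
    "?b \<le> ?N + halfwidth \<longleftrightarrow> ?b * (?Q - 2) \<le> ?Q * ?N"
    using le_halfwidth_iff[of 1] le_halfwidth_iff[of "1 - ?b"] le_halfwidth_iff[of ?b]
      le_halfwidth_iff[of "?b - ?N"]
    by (simp_all add: algebra_simps)
  show ?thesis
    unfolding T_def[symmetric] connected_T_iff
  proof (intro conjI impI)
    assume "\<bar>q\<bar> = 2"
    then have "?Q = 2" by simp
    then have "?Q - 1 - ?N \<le> ?b" "?b * (?Q - 2) \<le> ?Q * ?N" using N by simp_all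
    then show "1 \<le> halfwidth \<and> ?b \<le> ?N + halfwidth \<or> 1 - ?b \<le> halfwidth \<and> ?b \<le> halfwidth"
      unfolding hw by blast
  next
    assume "3 \<le> \<bar>q\<bar>"
    then have Q3: "0 < ?Q - 2" by linarith
    have "real_of_int (\<bar>q\<bar> * (\<bar>q\<bar> - n)) \<le> \<bar>a\<bar> \<longleftrightarrow> ?Q * (?Q - 1 - ?N) \<le> ?Q * ?b"
      unfolding a by simp
    also have "\<dots> \<longleftrightarrow> ?Q - 1 - ?N \<le> ?b" using Q by (simp only: mult_le_cancel_left) linarith
    finally have 1: "real_of_int (\<bar>q\<bar> * (\<bar>q\<bar> - n)) \<le> \<bar>a\<bar> \<longleftrightarrow> ?Q - 1 - ?N \<le> ?b" .
    have sq: "real_of_int (q\<^sup>2 * (n - 1)) = ?Q * (?Q * ?N)"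
      by (simp add: power2_eq_square flip: mult.assoc)
    have "\<bar>a\<bar> \<le> real_of_int (q\<^sup>2 * (n - 1)) / real_of_int (\<bar>q\<bar> - 2)
        \<longleftrightarrow> ?Q * (?b * (?Q - 2)) \<le> ?Q * (?Q * ?N)"
      unfolding a sq using Q3 by (simp add: pos_le_divide_eq mult.assoc)
    also have "\<dots> \<longleftrightarrow> ?b * (?Q - 2) \<le> ?Q * ?N" using Q by (simp only: mult_le_cancel_left) linarith
    finally have 2: "\<bar>a\<bar> \<le> real_of_int (q\<^sup>2 * (n - 1)) / real_of_int (\<bar>q\<bar> - 2)
        \<longleftrightarrow> ?b * (?Q - 2) \<le> ?Q * ?N" .
    have 3: "real_of_int (\<bar>q\<bar> - n) \<le> \<bar>a\<bar> \<longleftrightarrow> ?Q - 1 - ?N \<le> ?Q * ?b"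
      unfolding a by simp
    have "\<bar>a\<bar> \<le> real_of_int (\<bar>q\<bar> * (n - 1)) / real_of_int (\<bar>q\<bar> - 2)
        \<longleftrightarrow> ?Q * (?b * (?Q - 2)) \<le> ?Q * ?N"
      unfolding a using Q3 by (simp add: pos_le_divide_eq mult.assoc)
    also have "\<dots> \<longleftrightarrow> ?b * (?Q - 2) \<le> ?N" using Q by (simp only: mult_le_cancel_left) linarith
    finally have 4: "\<bar>a\<bar> \<le> real_of_int (\<bar>q\<bar> * (n - 1)) / real_of_int (\<bar>q\<bar> - 2)
        \<longleftrightarrow> ?b * (?Q - 2) \<le> ?N" .
    show "(1 \<le> halfwidth \<and> ?b \<le> ?N + halfwidth \<or> 1 - ?b \<le> halfwidth \<and> ?b \<le> halfwidth) \<longleftrightarrow>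
      (real_of_int (\<bar>q\<bar> * (\<bar>q\<bar> - n)) \<le> \<bar>a\<bar> \<and>
          \<bar>a\<bar> \<le> real_of_int (q\<^sup>2 * (n - 1)) / real_of_int (\<bar>q\<bar> - 2)) \<or>
        (real_of_int (\<bar>q\<bar> - n) \<le> \<bar>a\<bar> \<and>
          \<bar>a\<bar> \<le> real_of_int (\<bar>q\<bar> * (n - 1)) / real_of_int (\<bar>q\<bar> - 2))"
      unfolding hw 1 2 3 4 ..
  qed
qed

end
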